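(* Let $G=(V,E)$ be a homogeneous graph on $V=\{1,\dots,m\}$ with vertices ordered so that $V\in S_H$, let $U$ be an $m\times m$ positive definite matrix and let $\alpha\in\mathbb{R}^m$ have nonnegative entries. Then $z_G(U,\alpha)<\infty$ if and only if $\alpha_i>|\mathcal{N}^{\prec}(i)|+2$ for all $i=1,\dots,m$. In this case, $$z_G(U,\alpha)=\prod_{i=1}^m\frac{\Gamma\Big(\frac{\alpha_i}{2}-\frac{|\mathcal{N}^{\prec}(i)|}{2}-1\Big)\,2^{\alpha_i/2-1}\,(\sqrt{\pi})^{|\mathcal{N}^{\prec}(i)|}\,|U^{\prec i}|^{\alpha_i/2-|\mathcal{N}^{\prec}(i)|/2-3/2}}{|U^{\preceq i}|^{\alpha_i/2-|\mathcal{N}^{\prec}(i)|/2-1}} .$$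
   Context: Edges are undirected, no loops. $G$ is homogeneous if for every $(i,j)\in E$, with $N[i]=\{i\}\cup\{u:(u,i)\in E\}$, either $N[j]\subseteq N[i]$ or $N[i]\subseteq N[j]$. $P_G$ is the set of $m\times m$ symmetric positive definite matrices $\Sigma$ with $\Sigma_{ij}=0$ whenever $i\ne j$ and $(i,j)\notin E$. $\mathcal{L}_G$ is the set of lower-triangular $m\times m$ matrices $L$ with unit diagonal and $L_{ij}=0$ for $i>j$, $(i,j)\notin E$. $\Theta_G=\{(L,D):L\in\mathcal{L}_G,\ D\text{ diagonal},\ D_{ii}>0\}$. The modified Cholesky decomposition of a positive definite $\Sigma$ is the unique $\Sigma=LDL^T$ with $L$ lower-triangular with unit diagonal and $D$ diagonal with positive entries. The ordering condition $V\in S_H$ means: (i) for every positive definite $\Sigma=LDL^T$ (modified Cholesky), $L\in\mathcal{L}_G\Leftrightarrow\Sigma\in P_G$; and (ii) for lower-triangular $L$ with unit diagonal, $L\in\mathcal{L}_G\Leftrightarrow L^{-1}\in\mathcal{L}_G$. $$z_G(U,\alpha)=\int_{\Theta_G}\exp\Big(-\tfrac12\Big\{\operatorname{tr}((LDL^T)^{-1}U)+\sum_{i=1}^m\alpha_i\log D_{ii}\Big\}\Big)\,dL\,dD,$$ with $dL\,dD=\prod_{(i,j)\in E,\,i>j}dL_{ij}\prod_{i=1}^m dD_{ii}$. $\mathcal{N}^{\prec}(i)=\{j:(i,j)\in E,\ j<i\}$; $U^{\prec i}=(U_{kl})_{k,l\in\mathcal{N}^{\prec}(i)}$; $U^{\preceq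 i}=(U_{kl})_{k,l\in\mathcal{N}^{\prec}(i)\cup\{i\}}$; $|A|$ for a matrix is its determinant (equal to $1$ for an empty matrix), and for a set is its cardinality. $\Gamma$ is the Gamma function. *)

theory Defs
  imports "HOL-Analysis.Analysis"
begin

text \<open>
  The vertex set \<open>{1, ..., m}\<close> with its ordering is rendered as a finite linearly
  ordered index type \<open>'n\<close>, so \<open>m = CARD('n)\<close>. A graph is its edge relation
  \<open>E\<close>, a symmetric and irreflexive set of pairs.
\<close>

type_synonym 'n sq_matrix = "((real, 'n) vec, 'n) vec"

definition graph :: "('n \<times> 'n) set \<Rightarrow> bool" where
  "graph E \<longleftrightarrow> sym E \<and> irrefl E"

definition closed_nbhd :: "('n \<times> 'n) set \<Rightarrow> 'n \<Rightarrow> 'n set" where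
  "closed_nbhd E i = {i} \<union> {u. (u, i) \<in> E}"

definition homogeneous :: "('n \<times> 'n) set \<Rightarrow> bool" where
  "homogeneous E \<longleftrightarrow>
     (\<forall>(i, j)\<in>E. closed_nbhd E j \<subseteq> closed_nbhd E i \<or> closed_nbhd E i \<subseteq> closed_nbhd E j)"

definition pred_nbhd :: "('n::linorder \<times> 'n) set \<Rightarrow> 'n \<Rightarrow> 'n set" where
  "pred_nbhd E i = {j. (i, j) \<in> E \<and> j < i}"

definition pos_def :: "('n::finite) sq_matrix \<Rightarrow> bool" where
  "pos_def A \<longleftrightarrow> transpose A = A \<and> (\<forall>x. x \<noteq> 0 \<longrightarrow> x \<bullet> (A *v x) > 0)"

definition unit_lower_triangular :: "('n::{finite,linorder}) sq_matrix \<Rightarrow> bool" where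
  "unit_lower_triangular L \<longleftrightarrow> (\<forall>i. L $ i $ i = 1) \<and> (\<forall>i j. i < j \<longrightarrow> L $ i $ j = 0)"

definition pos_diagonal :: "('n::finite) sq_matrix \<Rightarrow> bool" where
  "pos_diagonal D \<longleftrightarrow> (\<forall>i j. i \<noteq> j \<longrightarrow> D $ i $ j = 0) \<and> (\<forall>i. 0 < D $ i $ i)"

definition P_G :: "('n::finite \<times> 'n) set \<Rightarrow> ('n sq_matrix) set" where
  "P_G E = {\<Sigma>. pos_def \<Sigma> \<and> (\<forall>i j. i \<noteq> j \<and> (i, j) \<notin> E \<longrightarrow> \<Sigma> $ i $ j = 0)}"

definition L_G :: "('n::{finite,linorder} \<times> 'n) set \<Rightarrow> ('n sq_matrix) set" where
  "L_G E = {L. unit_lower_triangular L \<and> (\<forall>i j. j < i \<and> (i, j) \<notin> E \<longrightarrow> L $ i $ j = 0)}"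

definition Theta_G :: "('n::{finite,linorder} \<times> 'n) set \<Rightarrow> (('n sq_matrix) \<times> ('n sq_matrix)) set" where
  "Theta_G E = {(L, D). L \<in> L_G E \<and> pos_diagonal D}"

definition modified_cholesky ::
    "('n::{finite,linorder}) sq_matrix \<Rightarrow> 'n sq_matrix \<Rightarrow> 'n sq_matrix \<Rightarrow> bool" where
  "modified_cholesky \<Sigma> L D \<longleftrightarrow>
     unit_lower_triangular L \<and> pos_diagonal D \<and> \<Sigma> = L ** D ** transpose L"

text \<open>\<open>S_H E\<close> says that the ordering of the index type lies in \<open>S_H\<close> for the graph \<open>E\<close>.\<close>

definition S_H :: "('n::{finite,linorder} \<times> 'n) set \<Rightarrow> bool" where
  "S_H E \<longleftrightarrow>
     (\<forall>\<Sigma> L D. pos_def \<Sigma> \<and> modified_cholesky \<Sigma> L D \<longrightarrow> (L \<in> L_G E \<longleftrightarrow> \<Sigma> \<in> P_G E)) \<and>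
     (\<forall>L. unit_lower_triangular L \<longrightarrow> (L \<in> L_G E \<longleftrightarrow> matrix_inv L \<in> L_G E))"

text \<open>
  The determinant of the principal submatrix with rows and columns in \<open>S\<close>, by the Leibniz
  formula that defines \<^const>\<open>det\<close>, with \<open>S\<close> in place of \<^const>\<open>UNIV\<close>.
\<close>

definition principal_det :: "('n::finite) sq_matrix \<Rightarrow> 'n set \<Rightarrow> real" where
  "principal_det A S = (\<Sum>p | p permutes S. of_int (sign p) * (\<Prod>i\<in>S. A $ i $ p i))"

lemma principal_det_UNIV: "principal_det A UNIV = det A"
  by (simp add: principal_det_def det_def)

lemma principal_det_empty: "principal_det A {} = 1"
  by (simp add: principal_det_def)

text \<open>
  The free coordinates of \<open>Theta_G E\<close> are the entries \<open>l (i, j)\<close> of \<open>L\<close> at the edges with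
  \<open>j < i\<close> and the diagonal entries \<open>d i\<close> of \<open>D\<close>; \<open>dL dD\<close> is Lebesgue measure in these
  coordinates.
\<close>

definition lower_edges :: "('n::linorder \<times> 'n) set \<Rightarrow> ('n \<times> 'n) set" where
  "lower_edges E = {(i, j). (i, j) \<in> E \<and> j < i}"

definition L_of :: "('n::{finite,linorder} \<times> 'n) set \<Rightarrow> ('n \<times> 'n \<Rightarrow> real) \<Rightarrow> 'n sq_matrix" where
  "L_of E l = (\<chi> i j. if i = j then 1 else if (i, j) \<in> lower_edges E then l (i, j) else 0)"

definition D_of :: "('n::finite \<Rightarrow> real) \<Rightarrow> 'n sq_matrix" where
  "D_of d = (\<chi> i j. if i = j then d i else 0)"

definition dL_dD ::
    "('n::{finite,linorder} \<times> 'n) set \<Rightarrow> (('n \<times> 'n \<Rightarrow> real) \<times> ('n \<Rightarrow> real)) measure" where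
  "dL_dD E = (\<Pi>\<^sub>M e\<in>lower_edges E. lborel) \<Otimes>\<^sub>M (\<Pi>\<^sub>M i\<in>UNIV. lborel)"

definition z_integrand ::
    "('n::finite) sq_matrix \<Rightarrow> (real, 'n) vec \<Rightarrow> 'n sq_matrix \<Rightarrow> 'n sq_matrix \<Rightarrow> real" where
  "z_integrand U \<alpha> L D =
     exp (- (1/2) * (trace (matrix_inv (L ** D ** transpose L) ** U)
                     + (\<Sum>i\<in>UNIV. \<alpha> $ i * ln (D $ i $ i))))"

definition z_G :: "('n::{finite,linorder} \<times> 'n) set \<Rightarrow> 'n sq_matrix \<Rightarrow> (real, 'n) vec \<Rightarrow> ennreal" where
  "z_G E U \<alpha> =
     (\<integral>\<^sup>+ x \<in> {(l, d). (L_of E l, D_of d) \<in> Theta_G E}.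
        ennreal (z_integrand U \<alpha> (L_of E (fst x)) (D_of (snd x))) \<partial>dL_dD E)"

end

theory Submission
  imports Defs "HOL-Probability.Distributions"
begin

text \<open>
  Substitute \<open>T = L\<^sup>-\<^sup>1\<close>. By \<^const>\<open>S_H\<close>, \<open>T\<close> again has the zero pattern of the graph, and since
  inversion is a composition of shears and sign changes of single coordinates, the substitution
  preserves Lebesgue measure in the free entries. The trace becomes
  \<open>\<Sum>i. (t\<^sub>i \<bullet> U t\<^sub>i) / d\<^sub>i\<close> with \<open>t\<^sub>i\<close> the rows of \<open>T\<close>, so the integral factors over \<open>i\<close>. In each
  factor, a Gaussian integral over the free entries of \<open>t\<^sub>i\<close> replaces the quadratic form by its
  minimum, the Schur complement \<open>|U\<^sup>\<preceq>\<^sup>i| / |U\<^sup>\<prec>\<^sup>i|\<close>, and leaves an inverse gamma integral in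
  \<open>d\<^sub>i\<close>, which converges exactly when its shape parameter
  \<open>\<alpha>\<^sub>i/2 - |N\<^sup>\<prec>(i)|/2 - 1\<close> is positive.
\<close>

section \<open>Principal minors and Schur complements\<close>

text \<open>The submatrix is padded with the identity outside \<open>S\<close>, so that it stays on
  the full index type and determinants, invertibility and Cramer's rule for square matrices over
  \<open>'n\<close> apply to it.\<close>

definition principal_block :: "('n::finite) sq_matrix \<Rightarrow> 'n set \<Rightarrow> 'n sq_matrix" where
  "principal_block A S =
     (\<chi> i j. if i \<in> S \<and> j \<in> S then A $ i $ j else if i = j then 1 else 0)"

text \<open>In the Leibniz formula a permutation that moves a point outside \<open>S\<close> picks
  up a zero of the padding, so only permutations of \<open>S\<close> contribute.\<close>

lemma det_principal_block:
  fixes A :: "'n::finite sq_matrix"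
  shows "det (principal_block A S) = principal_det A S"
proof -
  let ?t = "\<lambda>p. of_int (sign p) * (\<Prod>i\<in>UNIV. principal_block A S $ i $ p i)"
  have "det (principal_block A S) = (\<Sum>p | p permutes UNIV. ?t p)"
    by (simp add: det_def)
  also have "\<dots> = (\<Sum>p | p permutes S. ?t p)"
  proof (rule sum.mono_neutral_right)
    show "finite {p. p permutes (UNIV :: 'n set)}" by (rule finite_permutations) simp
    show "{p. p permutes S} \<subseteq> {p. p permutes UNIV}"
      by (auto intro: permutes_subset)
    show "\<forall>p\<in>{p. p permutes UNIV} - {p. p permutes S}. ?t p = 0"
    proof
      fix p assume "p \<in> {p. p permutes (UNIV :: 'n set)} - {p. p permutes S}"
      then obtain i where "i \<notin> S" "p i \<noteq> i"
        by (auto simp: permutes_def)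
      then have "principal_block A S $ i $ p i = 0"
        by (auto simp: principal_block_def)
      then show "?t p = 0"
        using prod_zero[of UNIV "\<lambda>i. principal_block A S $ i $ p i"] by auto
    qed
  qed
  also have "\<dots> = (\<Sum>p | p permutes S. of_int (sign p) * (\<Prod>i\<in>S. A $ i $ p i))"
  proof (rule sum.cong)
    fix p assume "p \<in> {p. p permutes S}"
    then have p: "p permutes S" by simp
    have "(\<Prod>i\<in>UNIV. principal_block A S $ i $ p i) = (\<Prod>i\<in>S. principal_block A S $ i $ p i)"
      by (rule prod.mono_neutral_right)
         (auto simp: principal_block_def permutes_not_in[OF p])
    also have "\<dots> = (\<Prod>i\<in>S. A $ i $ p i)"
      by (rule prod.cong) (auto simp: principal_block_def permutes_in_image[OF p])
    finally show "?t p = of_int (sign p) * (\<Prod>i\<in>S. A $ i $ p i)" by simp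
  qed simp
  finally show ?thesis by (simp add: principal_det_def)
qed

lemma principal_block_mult_in:
  assumes "\<And>j. j \<notin> S \<Longrightarrow> x $ j = 0" and "i \<in> S"
  shows "(principal_block A S *v x) $ i = (A *v x) $ i"
  unfolding matrix_vector_mult_def principal_block_def
  using assms by (auto intro!: sum.cong)

lemma principal_block_mult_out:
  assumes "i \<notin> S"
  shows "(principal_block A S *v x) $ i = x $ i"
  unfolding matrix_vector_mult_def principal_block_def
  using assms by (simp add: if_distrib[of "\<lambda>c. c * _"] cong: if_cong)

section \<open>Orthogonality with respect to a positive definite form\<close>

lemma pos_def_sym: "pos_def U \<Longrightarrow> U $ i $ j = U $ j $ i"
  unfolding pos_def_def by (metis (no_types, lifting) transpose_def vec_lambda_beta)

lemma pos_def_swap: "pos_def U \<Longrightarrow> x \<bullet> (U *v y) = y \<bullet> (U *v x)"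
  unfolding pos_def_def by (metis dot_lmul_matrix inner_commute vector_transpose_matrix)

text \<open>These are the normal equations for minimizing the form of \<open>U\<close> over
  \<open>v\<close> plus the coordinate directions in \<open>S\<close>. They are solvable because a
  kernel vector of the padded block is supported in \<open>S\<close> and has form value 0.\<close>

lemma pos_def_orthogonal_extension:
  assumes U: "pos_def U"
  obtains w where "\<And>j. j \<notin> S \<Longrightarrow> w $ j = 0" "\<And>j. j \<in> S \<Longrightarrow> (U *v (v + w)) $ j = 0"
proof -
  let ?M = "principal_block U S"
  have "x = 0" if x: "?M *v x = 0" for x
  proof (rule ccontr)
    assume "x \<noteq> 0"
    have x0: "x $ j = 0" if "j \<notin> S" for j
      using principal_block_mult_out[OF that, of U x] x by simp
    have "(U *v x) $ j = 0" if "j \<in> S" for j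
      using principal_block_mult_in[of S x j U] x0 that x by simp
    with x0 have "x \<bullet> (U *v x) = 0"
      unfolding inner_vec_def by (intro sum.neutral) (metis inner_zero_left inner_zero_right)
    with U \<open>x \<noteq> 0\<close> show False unfolding pos_def_def by fastforce
  qed
  then have "inj ((*v) ?M)"
    by (metis matrix_left_invertible_injective matrix_left_invertible_ker)
  then have "surj ((*v) ?M)"
    by (metis matrix_left_invertible_injective matrix_left_right_inverse matrix_right_invertible_surjective)
  \<comment> \<open>Outside \<open>S\<close> the rows of \<open>?M\<close> are those of the
    identity, so the zeros of the right-hand side give the support condition on
    \<open>w\<close>.\<close>
  then obtain w where w: "?M *v w = (\<chi> j. if j \<in> S then - (U *v v) $ j else 0)"
    by (metis surjD)
  have w0: "w $ j = 0" if "j \<notin> S" for j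
    using principal_block_mult_out[OF that, of U w] w that by simp
  have "(U *v (v + w)) $ j = 0" if "j \<in> S" for j
    using principal_block_mult_in[of S w j U] w0 that w
    by (simp add: matrix_vector_right_distrib)
  with w0 show thesis using that by blast
qed

lemma orthogonal_extension_form:
  fixes k :: "'n::finite"
  assumes "k \<notin> S" "\<And>j. j \<notin> S \<Longrightarrow> w $ j = 0"
    and "\<And>j. j \<in> S \<Longrightarrow> z $ j = (0::real)"
  shows "(axis k 1 + w) \<bullet> z = z $ k"
proof -
  have "w \<bullet> z = 0"
    unfolding inner_vec_def using assms by (intro sum.neutral) (metis inner_zero_left inner_zero_right)
  then show ?thesis by (simp add: inner_add_left inner_axis' )
qed

text \<open>The vector \<open>y\<close> minimizes the form over \<open>axis k 1\<close> plus the
  coordinate directions in \<open>S\<close>, so \<open>y \<bullet> (U *v y)\<close> is the Schur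
  complement of the block on \<open>S\<close>. Cramer's rule, applied twice, replaces block
  elimination.\<close>

lemma principal_det_insert:
  assumes U: "pos_def U" and k: "k \<notin> S"
    and w: "\<And>j. j \<notin> S \<Longrightarrow> w $ j = 0" "\<And>j. j \<in> S \<Longrightarrow> (U *v (axis k 1 + w)) $ j = 0"
  defines "y \<equiv> axis k 1 + w"
  shows "principal_det U (insert k S) = y \<bullet> (U *v y) * principal_det U S"
proof -
  let ?N = "principal_block U (insert k S)" and ?P = "principal_block U S"
  define s where "s = y \<bullet> (U *v y)"
  have s: "s = (U *v y) $ k"
    unfolding s_def y_def using k w by (intro orthogonal_extension_form) auto
  have yk: "y $ k = 1" using k w(1) by (simp add: y_def axis_def)
  have N_y: "(?N *v y) $ i = (if i = k then s else 0)" for i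
  proof (cases "i \<in> insert k S")
    case True
    then have "(?N *v y) $ i = (U *v y) $ i"
      using w(1) by (intro principal_block_mult_in) (auto simp: y_def axis_def)
    with True w(2) s show ?thesis by (auto simp: y_def)
  next
    case False
    with w(1) show ?thesis by (simp add: principal_block_mult_out) (auto simp: y_def axis_def)
  qed
  let ?R = "\<chi> i j. if j = k then (if i = k then 1 else 0) else ?N $ i $ j"
  have "principal_det U (insert k S) = y $ k * det ?N"
    by (simp add: det_principal_block yk)
  \<comment> \<open>Cramer's rule for \<open>?N\<close> and \<open>y\<close>: the image of
    \<open>y\<close> is \<open>s\<close> times the unit vector at \<open>k\<close>. The
    transposition below turns column \<open>k\<close> into a row, from which \<open>s\<close> can be
    pulled out.\<close>
  also have "\<dots> = det (\<chi> i j. if j = k then (if i = k then s else 0) else ?N $ i $ j)"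
    using cramer_lemma[of k ?N y, unfolded N_y] by (rule sym)
  also have "\<dots> = det (transpose (\<chi> i j. if j = k then (if i = k then s else 0) else ?N $ i $ j))"
    by (simp add: det_transpose)
  also have "transpose (\<chi> i j. if j = k then (if i = k then s else 0) else ?N $ i $ j)
      = (\<chi> i. if i = k then s *s transpose ?R $ k else transpose ?R $ i)"
    by (simp add: vec_eq_iff transpose_def)
  also have "det \<dots> = s * det (\<chi> i. if i = k then transpose ?R $ k else transpose ?R $ i)"
    by (rule det_row_mul)
  also have "(\<chi> i. if i = k then transpose ?R $ k else transpose ?R $ i) = transpose ?R"
    by (simp add: vec_eq_iff)
  \<comment> \<open>Cramer's rule read backwards: off column \<open>k\<close> the matrix is
    \<open>?P\<close>, and column \<open>k\<close> is the image of \<open>axis k 1 - w\<close>,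
    whose coordinate \<open>k\<close> is 1. On \<open>S\<close> this uses that \<open>U *v w\<close>
    is minus column \<open>k\<close> of \<open>U\<close>.\<close>
  also have "transpose ?R = (\<chi> i j. if j = k then (?P *v (axis k 1 - w)) $ i else ?P $ i $ j)"
  proof -
    have "(?P *v (axis k 1 - w)) $ i = (if i = k then 1 else ?N $ k $ i)" for i
    proof (cases "i \<in> S")
      case True
      have "(?P *v axis k 1) $ i = 0"
        using True k by (auto simp: matrix_vector_mul_component inner_axis principal_block_def)
      moreover have "(?P *v w) $ i = (U *v w) $ i"
        using True w(1) by (intro principal_block_mult_in) auto
      moreover have "(U *v w) $ i = - U $ i $ k"
        using w(2)[OF True] by (simp add: matrix_vector_right_distrib matrix_vector_mul_component inner_axis)
      ultimately show ?thesis
        using True k by (auto simp: matrix_vector_mult_diff_distrib principal_block_def pos_def_sym[OF U])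
    next
      case False
      then show ?thesis
        using k w(1) by (simp add: principal_block_mult_out) (auto simp: principal_block_def axis_def)
    qed
    then show ?thesis
      using k pos_def_sym[OF U] by (auto simp: vec_eq_iff transpose_def principal_block_def)
  qed
  also have "det \<dots> = (axis k 1 - w) $ k * det ?P" by (rule cramer_lemma)
  finally show ?thesis using k w(1) by (simp add: det_principal_block s_def axis_def)
qed

text \<open>Adding one index multiplies the minor by a Schur complement, which is the value of the
  form of \<open>U\<close> at a nonzero vector.\<close>

lemma principal_det_pos:
  assumes U: "pos_def U"
  shows "0 < principal_det U S"
proof -
  have "finite S" by simp
  then show ?thesis
  proof induction
    case empty
    then show ?case by (simp add: principal_det_empty)
  next
    case (insert k S)
    obtain w where w: "\<And>j. j \<notin> S \<Longrightarrow> w $ j = 0" "\<And>j. j \<in> S \<Longrightarrow> (U *v (axis k 1 + w)) $ j = 0"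
      using pos_def_orthogonal_extension[OF U] by blast
    have "(axis k 1 + w) $ k = 1" using insert w(1) by (simp add: axis_def)
    then have "axis k 1 + w \<noteq> 0" by (metis zero_index zero_neq_one)
    then show ?case
      using principal_det_insert[OF U \<open>k \<notin> S\<close> w] insert.IH U by (simp add: pos_def_def)
  qed
qed

section \<open>Gaussian integrals over a row\<close>

lemma product_sigma_finite_lborel: "product_sigma_finite (\<lambda>_. lborel)"
  by (simp add: product_sigma_finite_def sigma_finite_lborel)

text \<open>Up to a constant the integrand is the normal density with mean \<open>m\<close> and
  variance \<open>1 / s\<close>, whose total mass is 1.\<close>

lemma nn_integral_gaussian:
  fixes s m :: real
  assumes "0 < s"
  shows "(\<integral>\<^sup>+ x. ennreal (exp (- ((x - m)\<^sup>2 * s) / 2)) \<partial>lborel) = ennreal (sqrt (2 * pi / s))"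
proof -
  define \<sigma> where "\<sigma> = sqrt (1 / s)"
  have \<sigma>: "0 < \<sigma>" "\<sigma>\<^sup>2 = 1 / s" using assms by (auto simp: \<sigma>_def)
  interpret prob_space "density lborel (normal_density m \<sigma>)"
    by (rule prob_space_normal_density) fact
  have 1: "(\<integral>\<^sup>+ x. ennreal (normal_density m \<sigma> x) \<partial>lborel) = 1"
    using emeasure_space_1 by (simp add: emeasure_density)
  have "exp (- ((x - m)\<^sup>2 * s) / 2) = sqrt (2 * pi / s) * normal_density m \<sigma> x" for x
    using assms by (simp add: normal_density_def \<sigma> real_sqrt_divide real_sqrt_mult)
  then have "(\<integral>\<^sup>+ x. ennreal (exp (- ((x - m)\<^sup>2 * s) / 2)) \<partial>lborel)
      = (\<integral>\<^sup>+ x. ennreal (sqrt (2 * pi / s)) * ennreal (normal_density m \<sigma> x) \<partial>lborel)"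
    using assms by (intro nn_integral_cong) (simp add: ennreal_mult')
  also have "\<dots> = ennreal (sqrt (2 * pi / s))"
    by (simp add: nn_integral_cmult 1)
  finally show ?thesis .
qed

text \<open>Zero padding makes the free entries of a row a vector to which \<open>U\<close> applies.
  The coordinates keep their row index, so the blocks of different rows are disjoint.\<close>

definition row_vec :: "'i \<Rightarrow> 'n set \<Rightarrow> ('i \<times> 'n \<Rightarrow> real) \<Rightarrow> real ^ 'n::finite" where
  "row_vec i S t = (\<chi> j. if j \<in> S then t (i, j) else 0)"

lemma row_vec_nth: "row_vec i S t $ j = (if j \<in> S then t (i, j) else 0)"
  by (simp add: row_vec_def)

lemma measurable_row_vec_nth:
  assumes "{i} \<times> S \<subseteq> I"
  shows "(\<lambda>t. row_vec i S t $ j) \<in> borel_measurable (PiM I (\<lambda>_. lborel))"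
  using assms measurable_component_singleton[of "(i,j)" I "\<lambda>_. lborel"]
  by (cases "j \<in> S") (auto simp: row_vec_nth)

lemma quadratic_form_eq_sum:
  "(x::real^'n) \<bullet> (U *v x) = (\<Sum>a\<in>UNIV. \<Sum>b\<in>UNIV. x $ a * (U $ a $ b * x $ b))"
  by (simp add: inner_vec_def matrix_vector_mult_def sum_distrib_left)

lemma measurable_quadratic_form_row_vec:
  fixes U :: "'n::finite sq_matrix"
  assumes "{i} \<times> S \<subseteq> I"
  shows "(\<lambda>t. (v + row_vec i S t) \<bullet> (U *v (v + row_vec i S t)))
    \<in> borel_measurable (PiM I (\<lambda>_. lborel))"
  unfolding quadratic_form_eq_sum vector_add_component
  using measurable_row_vec_nth[OF assms, measurable] by measurable

text \<open>
  The shift \<open>w\<close> is arbitrary because integrating out one coordinate moves the critical point \<open>z\<close>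
  together with the origin of the remaining coordinates.
\<close>

lemma nn_integral_gaussian_row:
  fixes U :: "'n::finite sq_matrix" and i :: 'i
  assumes U: "pos_def U" and d: "0 < d"
  shows "(\<And>j. j \<in> S \<Longrightarrow> (U *v z) $ j = 0) \<Longrightarrow> (\<And>j. j \<notin> S \<Longrightarrow> w $ j = 0) \<Longrightarrow>
    (\<integral>\<^sup>+ t. ennreal (exp (- ((z - w + row_vec i S t) \<bullet> (U *v (z - w + row_vec i S t)) / d) / 2))
        \<partial>PiM ({i} \<times> S) (\<lambda>_. lborel))
      = ennreal (exp (- (z \<bullet> (U *v z) / d) / 2) * (sqrt (2 * pi * d) ^ card S / sqrt (principal_det U S)))"
proof -
  interpret product_sigma_finite "\<lambda>_ :: 'i \<times> 'n. lborel :: real measure"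
    by (rule product_sigma_finite_lborel)
  let ?q = "\<lambda>x. x \<bullet> (U *v x)"
  let ?c = "\<lambda>S. sqrt (2 * pi * d) ^ card S / sqrt (principal_det U S)"
  have "finite S" by simp
  then show "(\<And>j. j \<in> S \<Longrightarrow> (U *v z) $ j = 0) \<Longrightarrow> (\<And>j. j \<notin> S \<Longrightarrow> w $ j = 0) \<Longrightarrow> ?thesis"
  proof (induction arbitrary: z w)
    case empty
    then have "w = 0" by (simp add: vec_eq_iff)
    moreover have "row_vec i {} t = 0" for t :: "'i \<times> 'n \<Rightarrow> real"
      by (simp add: vec_eq_iff row_vec_nth)
    ultimately show ?case
      by (simp add: PiM_empty principal_det_empty)
  next
    case (insert k S)
    obtain u where u: "\<And>j. j \<notin> S \<Longrightarrow> u $ j = 0" "\<And>j. j \<in> S \<Longrightarrow> (U *v (axis k 1 + u)) $ j = 0"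
      using pos_def_orthogonal_extension[OF U] by blast
    \<comment> \<open>Moving along \<open>y\<close> keeps a point critical on \<open>S\<close>,
      while its coordinate \<open>k\<close> moves at unit speed.\<close>
    define y where "y = axis k 1 + u"
    define s where "s = ?q y"
    have yk: "y $ k = 1" using u(1) insert.hyps by (simp add: y_def axis_def)
    then have "y \<noteq> 0" by (metis zero_index zero_neq_one)
    then have s: "0 < s" using U by (simp add: s_def pos_def_def)
    have det: "principal_det U (insert k S) = s * principal_det U S"
      using principal_det_insert[OF U \<open>k \<notin> S\<close> u] by (simp add: s_def y_def)
    have yz: "y \<bullet> (U *v z) = 0"
      unfolding y_def
      using orthogonal_extension_form[of k S u "U *v z"] u(1) insert.prems insert.hyps by auto
    \<comment> \<open>Pythagoras: \<open>y\<close> and \<open>z\<close> are orthogonal for the form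
      of \<open>U\<close>.\<close>
    have q: "?q (z + c *\<^sub>R y) = ?q z + c\<^sup>2 * s" for c
      using yz pos_def_swap[OF U, of z y]
      by (simp add: s_def inner_add_left inner_add_right matrix_vector_right_distrib
          matrix_vector_mult_scaleR power2_eq_square)
    have inner: "(\<integral>\<^sup>+ t. ennreal (exp (- (?q (z - w + row_vec i (insert k S) (t((i, k) := \<tau>))) / d) / 2))
        \<partial>PiM ({i} \<times> S) (\<lambda>_. lborel))
      = ennreal (exp (- ((\<tau> - w $ k)\<^sup>2 * (s / d)) / 2)) * ennreal (exp (- (?q z / d) / 2) * ?c S)" for \<tau>
    proof -
      \<comment> \<open>For fixed \<open>\<tau>\<close>, \<open>z'\<close> is critical on
        \<open>S\<close>. The choice of \<open>w'\<close> gives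
        \<open>z' - w' = z - w + axis k \<tau>\<close>, and its coordinate \<open>k\<close> cancels,
        so the induction hypothesis applies to \<open>S\<close>.\<close>
      define z' where "z' = z + (\<tau> - w $ k) *\<^sub>R y"
      define w' where "w' = w + (\<tau> - w $ k) *\<^sub>R y - axis k \<tau>"
      have "z - w + row_vec i (insert k S) (t((i, k) := \<tau>)) = z' - w' + row_vec i S t" for t
        using insert.hyps by (simp add: vec_eq_iff z'_def w'_def row_vec_nth axis_def)
      moreover have "(U *v z') $ j = 0" if "j \<in> S" for j
        using insert.prems u(2)[OF that] that
        by (simp add: z'_def y_def matrix_vector_right_distrib matrix_vector_mult_scaleR)
      moreover have "w' $ j = 0" if "j \<notin> S" for j
        using insert.prems u(1) that yk by (cases "j = k") (auto simp: w'_def y_def axis_def)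
      ultimately have "(\<integral>\<^sup>+ t. ennreal (exp (- (?q (z - w + row_vec i (insert k S) (t((i, k) := \<tau>))) / d) / 2))
          \<partial>PiM ({i} \<times> S) (\<lambda>_. lborel)) = ennreal (exp (- (?q z' / d) / 2) * ?c S)"
        using insert.IH[of z' w'] by simp
      also have "exp (- (?q z' / d) / 2) = exp (- ((\<tau> - w $ k)\<^sup>2 * (s / d)) / 2) * exp (- (?q z / d) / 2)"
        unfolding z'_def q by (simp add: exp_add[symmetric] add_divide_distrib mult.commute)
      finally show ?thesis by (simp only: mult.assoc ennreal_mult'[OF exp_ge_zero])
    qed
    have "{i} \<times> insert k S = insert (i, k) ({i} \<times> S)" by auto
    then have "(\<integral>\<^sup>+ t. ennreal (exp (- (?q (z - w + row_vec i (insert k S) t) / d) / 2))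
        \<partial>PiM ({i} \<times> insert k S) (\<lambda>_. lborel))
      = (\<integral>\<^sup>+ \<tau>. (\<integral>\<^sup>+ t. ennreal (exp (- (?q (z - w + row_vec i (insert k S) (t((i, k) := \<tau>))) / d) / 2))
        \<partial>PiM ({i} \<times> S) (\<lambda>_. lborel)) \<partial>lborel)"
      using insert.hyps measurable_quadratic_form_row_vec[of i "insert k S" "{i} \<times> insert k S" "z - w" U, measurable]
      by (simp only:) (rule product_nn_integral_insert_rev, auto)
    also have "\<dots> = (\<integral>\<^sup>+ \<tau>. ennreal (exp (- ((\<tau> - w $ k)\<^sup>2 * (s / d)) / 2)) \<partial>lborel)
        * ennreal (exp (- (?q z / d) / 2) * ?c S)"
      unfolding inner by (rule nn_integral_multc) measurable
    also have "\<dots> = ennreal (sqrt (2 * pi / (s / d)) * (exp (- (?q z / d) / 2) * ?c S))"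
      using s d nn_integral_gaussian[of "s / d" "w $ k"]
      by (simp only: divide_pos_pos) (rule ennreal_mult'[symmetric], simp)
    \<comment> \<open>The integral over coordinate \<open>k\<close> supplies one more factor
      \<open>sqrt (2 * pi * d)\<close> and the factor \<open>1 / sqrt s\<close>, which turns the
      minor on \<open>S\<close> into the one on \<open>insert k S\<close>.\<close>
    also have "sqrt (2 * pi / (s / d)) * (exp (- (?q z / d) / 2) * ?c S)
        = exp (- (?q z / d) / 2) * ?c (insert k S)"
      using insert.hyps by (simp add: det real_sqrt_mult real_sqrt_divide)
    finally show ?case .
  qed
qed

section \<open>Product Lebesgue measure: shears and blocks\<close>

text \<open>With the other coordinates fixed, the map reflects and translates coordinate
  \<open>e\<close>, because \<open>g\<close> does not depend on it. Fubini then reduces the claim to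
  the invariance of Lebesgue measure on the line. The sign is the one with which an entry of
  \<open>L\<close> enters the corresponding entry of its inverse.\<close>

lemma distr_PiM_lborel_shear:
  fixes g :: "('i \<Rightarrow> real) \<Rightarrow> real"
  assumes "finite I" "e \<in> I"
    and [measurable]: "g \<in> borel_measurable (PiM I (\<lambda>_. lborel))"
    and g: "\<And>x c. g (x(e := c)) = g x"
  defines "M \<equiv> PiM I (\<lambda>_. lborel)"
  shows measurable_shear: "(\<lambda>x. x(e := g x - x e)) \<in> M \<rightarrow>\<^sub>M M"
    and distr_shear: "distr M M (\<lambda>x. x(e := g x - x e)) = M"
proof -
  interpret product_sigma_finite "\<lambda>_ :: 'i. lborel :: real measure"
    by (rule product_sigma_finite_lborel)
  let ?s = "\<lambda>x. x(e := g x - x e)"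
  have [measurable]: "(\<lambda>x. x e) \<in> M \<rightarrow>\<^sub>M lborel"
    using \<open>e \<in> I\<close> unfolding M_def by measurable
  have eq: "?s x = (\<lambda>i\<in>I. if i = e then g x - x e else x i)" if "x \<in> space M" for x
    using that \<open>e \<in> I\<close> by (auto simp: M_def space_PiM fun_eq_iff PiE_def extensional_def)
  have "(\<lambda>x. \<lambda>i\<in>I. if i = e then g x - x e else x i) \<in> M \<rightarrow>\<^sub>M M"
    unfolding M_def
  proof (rule measurable_restrict)
    fix i assume "i \<in> I"
    then show "(\<lambda>x. if i = e then g x - x e else x i) \<in> PiM I (\<lambda>_. lborel) \<rightarrow>\<^sub>M lborel"
      using \<open>e \<in> I\<close> by (cases "i = e") auto
  qed
  then show s[measurable]: "?s \<in> M \<rightarrow>\<^sub>M M"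
    using measurable_cong[of M ?s, OF eq] by blast
  define J where "J = I - {e}"
  have I: "I = insert e J" and J: "finite J" "e \<notin> J"
    using assms by (auto simp: J_def)
  have main: "(\<integral>\<^sup>+x. f (?s x) \<partial>M) = (\<integral>\<^sup>+x. f x \<partial>M)" if f[measurable]: "f \<in> borel_measurable M" for f
  proof -
    have "(\<integral>\<^sup>+x. f (?s x) \<partial>M) = (\<integral>\<^sup>+x. (\<integral>\<^sup>+y. f (?s (x(e := y))) \<partial>lborel) \<partial>PiM J (\<lambda>_. lborel))"
      unfolding M_def I
      by (rule product_nn_integral_insert[OF J]) (use s f in \<open>simp add: M_def I\<close>)
    also have "\<dots> = (\<integral>\<^sup>+x. (\<integral>\<^sup>+y. f (x(e := y)) \<partial>lborel) \<partial>PiM J (\<lambda>_. lborel))"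
    proof (rule nn_integral_cong)
      fix x assume x: "x \<in> space (PiM J (\<lambda>_. lborel :: real measure))"
      have [measurable]: "(\<lambda>y. f (x(e := y))) \<in> borel_measurable borel"
        using measurable_comp[OF measurable_component_update[OF x J(2)] f[unfolded M_def I]]
        by (simp add: comp_def)
      show "(\<integral>\<^sup>+y. f (?s (x(e := y))) \<partial>lborel) = (\<integral>\<^sup>+y. f (x(e := y)) \<partial>lborel)"
        by (subst (2) nn_integral_real_affine[where c = "-1" and t = "g x"]) (auto simp: g)
    qed
    also have "\<dots> = (\<integral>\<^sup>+x. f x \<partial>M)"
      unfolding M_def I
      by (rule product_nn_integral_insert[OF J, symmetric]) (use f in \<open>simp add: M_def I\<close>)
    finally show ?thesis .
  qed
  show "distr M M ?s = M"
  proof (rule measure_eqI)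
    fix A assume "A \<in> sets (distr M M ?s)"
    then have [measurable]: "A \<in> sets M" by simp
    have "emeasure (distr M M ?s) A = (\<integral>\<^sup>+x. indicator A x \<partial>distr M M ?s)"
      by simp
    also have "\<dots> = (\<integral>\<^sup>+x. indicator A (?s x) \<partial>M)"
      by (rule nn_integral_distr) auto
    also have "\<dots> = emeasure M A" using main[of "indicator A"] by simp
    finally show "emeasure (distr M M ?s) A = emeasure M A" .
  qed simp
qed

text \<open>Induction on \<open>R\<close>, splitting off one block by Fubini. Measurability is asked
  for every index set containing \<open>B r\<close>, since the same \<open>f r\<close> is integrated
  over the full product and over its own block.\<close>

lemma nn_integral_PiM_prod_blocks:
  fixes f :: "'r \<Rightarrow> ('i \<Rightarrow> real) \<Rightarrow> ennreal"
  assumes "finite R" and fin: "\<And>r. r \<in> R \<Longrightarrow> finite (B r)" and "disjoint_family_on B R"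
    and f: "\<And>r I. r \<in> R \<Longrightarrow> B r \<subseteq> I \<Longrightarrow> f r \<in> borel_measurable (PiM I (\<lambda>_. lborel))"
    and dep: "\<And>r x y. r \<in> R \<Longrightarrow> (\<And>b. b \<in> B r \<Longrightarrow> x b = y b) \<Longrightarrow> f r x = f r y"
  shows "(\<integral>\<^sup>+x. (\<Prod>r\<in>R. f r x) \<partial>PiM (\<Union>r\<in>R. B r) (\<lambda>_. lborel))
    = (\<Prod>r\<in>R. \<integral>\<^sup>+x. f r x \<partial>PiM (B r) (\<lambda>_. lborel))"
  using assms
proof (induction R)
  case empty
  show ?case by (simp add: PiM_empty nn_integral_count_space_finite)
next
  case (insert r R)
  interpret product_sigma_finite "\<lambda>_ :: 'i. lborel :: real measure"
    by (rule product_sigma_finite_lborel)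
  let ?V = "\<Union>r\<in>R. B r"
  have disj: "B r \<inter> ?V = {}"
    using insert.prems(2) insert.hyps by (auto simp: disjoint_family_on_def)
  have U: "(\<Union>r\<in>insert r R. B r) = B r \<union> ?V" by simp
  have m: "f q \<in> borel_measurable (PiM I (\<lambda>_. lborel))" if "q \<in> insert r R" "B q \<subseteq> I" for q I
    using insert.prems(3) that by blast
  have "(\<integral>\<^sup>+x. (\<Prod>q\<in>insert r R. f q x) \<partial>PiM (\<Union>r\<in>insert r R. B r) (\<lambda>_. lborel))
      = (\<integral>\<^sup>+x. (\<integral>\<^sup>+y. (\<Prod>q\<in>insert r R. f q (merge (B r) ?V (x, y))) \<partial>PiM ?V (\<lambda>_. lborel)) \<partial>PiM (B r) (\<lambda>_. lborel))"
    unfolding U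
  proof (rule product_nn_integral_fold[OF disj])
    show "(\<lambda>x. \<Prod>q\<in>insert r R. f q x) \<in> borel_measurable (PiM (B r \<union> ?V) (\<lambda>_. lborel))"
      by (intro borel_measurable_prod_ennreal m) auto
  qed (use insert.hyps insert.prems(1) in auto)
  also have "\<dots> = (\<integral>\<^sup>+x. (\<integral>\<^sup>+y. f r x * (\<Prod>q\<in>R. f q y) \<partial>PiM ?V (\<lambda>_. lborel)) \<partial>PiM (B r) (\<lambda>_. lborel))"
  proof (intro nn_integral_cong)
    fix x y :: "'i \<Rightarrow> real"
    have "f r (merge (B r) ?V (x, y)) = f r x"
      by (rule insert.prems(4)) (auto simp: merge_def)
    moreover have "f q (merge (B r) ?V (x, y)) = f q y" if "q \<in> R" for q
      using disj that by (intro insert.prems(4)) (auto simp: merge_def)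
    ultimately show "(\<Prod>q\<in>insert r R. f q (merge (B r) ?V (x, y))) = f r x * (\<Prod>q\<in>R. f q y)"
      using insert.hyps by simp
  qed
  also have "\<dots> = (\<integral>\<^sup>+x. f r x * (\<integral>\<^sup>+y. (\<Prod>q\<in>R. f q y) \<partial>PiM ?V (\<lambda>_. lborel)) \<partial>PiM (B r) (\<lambda>_. lborel))"
    by (intro nn_integral_cong nn_integral_cmult borel_measurable_prod_ennreal m) auto
  also have "\<dots> = (\<integral>\<^sup>+x. f r x \<partial>PiM (B r) (\<lambda>_. lborel)) * (\<integral>\<^sup>+y. (\<Prod>q\<in>R. f q y) \<partial>PiM ?V (\<lambda>_. lborel))"
    by (intro nn_integral_multc m) auto
  also have "(\<integral>\<^sup>+y. (\<Prod>q\<in>R. f q y) \<partial>PiM ?V (\<lambda>_. lborel)) = (\<Prod>r\<in>R. \<integral>\<^sup>+x. f r x \<partial>PiM (B r) (\<lambda>_. lborel))"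
  proof (rule insert.IH)
    show "disjoint_family_on B R"
      using insert.prems(2) by (auto simp: disjoint_family_on_def)
  qed (use insert.prems(1) in blast, rule m, blast, assumption, rule insert.prems(4), auto)
  finally show ?case using insert.hyps by simp
qed

section \<open>The inverse gamma integral\<close>

text \<open>The substitution \<open>t = b / x\<close>, a bijection of the open half-line, turns
  Euler's integral for \<open>Gamma a\<close> into this one, up to the factor
  \<open>b powr a\<close>.\<close>

lemma nn_integral_inverse_gamma:
  fixes a b :: real
  assumes "0 < a" "0 < b"
  shows "(\<integral>\<^sup>+x. ennreal (x powr (- a - 1) * exp (- b / x)) * indicator {0<..} x \<partial>lborel)
    = ennreal (Gamma a / b powr a)"
proof -
  let ?f = "\<lambda>t::real. t powr (a - 1) / exp t" and ?g = "\<lambda>x. b / x" and ?g' = "\<lambda>x. - b / x\<^sup>2"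
  have nonneg: "0 \<le> ?f t" for t by simp
  have img: "?g ` {0<..} = {0<..}"
  proof
    show "{0<..} \<subseteq> ?g ` {0<..}"
    proof
      fix x :: real assume "x \<in> {0<..}"
      then have "x = ?g (b / x)" "b / x \<in> {0<..}" using assms by auto
      then show "x \<in> ?g ` {0<..}" by (rule image_eqI)
    qed
  qed (use assms in auto)
  \<comment> \<open>Euler's integral is over the closed half-line; dropping the endpoint 0 makes the
    substitution legitimate.\<close>
  have "(?f has_integral Gamma a) {0<..}"
    using Gamma_integral_real[OF assms(1)]
    by (rule has_integral_spike_set_eq[THEN iffD1, rotated -1])
       (auto intro: negligible_subset[of "{0}"])
  then have "?f absolutely_integrable_on {0<..} \<and> integral {0<..} ?f = Gamma a"
    using nonneg by (auto intro: nonnegative_absolutely_integrable_1)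
  then have "(\<lambda>x. \<bar>?g' x\<bar> * ?f (?g x)) absolutely_integrable_on {0<..} \<and>
      integral {0<..} (\<lambda>x. \<bar>?g' x\<bar> * ?f (?g x)) = Gamma a"
    using assms
    by (subst has_absolute_integral_change_of_variables_1')
       (auto simp: img inj_on_def power2_eq_square intro!: derivative_eq_intros)
  then have "((\<lambda>x. \<bar>?g' x\<bar> * ?f (?g x)) has_integral Gamma a) {0<..}"
    using set_lebesgue_integral_eq_integral(1) by (metis integrable_integral)
  then have "((\<lambda>x. \<bar>?g' x\<bar> * ?f (?g x) / b powr a) has_integral (Gamma a / b powr a)) {0<..}"
    by (rule has_integral_divide)
  moreover have "\<bar>?g' x\<bar> * ?f (?g x) / b powr a = x powr (- a - 1) * exp (- b / x)" if "x \<in> {0<..}" for x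
  proof -
    have x: "0 < x" using that by simp
    have "- a - 1 = (1 - a) - 2" by simp
    then have "x powr (- a - 1) = x powr (1 - a) / x powr 2" by (simp only: powr_diff)
    moreover have "x powr (1 - a) = 1 / x powr (a - 1)"
      using x by (metis minus_diff_eq powr_minus_divide)
    ultimately show ?thesis
      using x assms by (simp add: powr_divide exp_minus powr_diff field_simps)
  qed
  ultimately have "((\<lambda>x. x powr (- a - 1) * exp (- b / x)) has_integral (Gamma a / b powr a)) {0<..}"
    by (subst (asm) has_integral_cong) auto
  then show ?thesis
    by (intro nn_integral_has_integral_lebesgue') auto
qed

text \<open>For \<open>a \<le> 0\<close> the integrand dominates \<open>exp (- b) / x\<close> on
  \<open>x \<ge> 1\<close>, and the integral of the latter diverges logarithmically.\<close>

lemma nn_integral_inverse_gamma_infinite: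
  fixes a b :: real
  assumes "a \<le> 0" "0 < b"
  shows "(\<integral>\<^sup>+x. ennreal (x powr (- a - 1) * exp (- b / x)) * indicator {0<..} x \<partial>lborel) = \<infinity>"
proof (rule ccontr)
  let ?I = "\<integral>\<^sup>+x. ennreal (x powr (- a - 1) * exp (- b / x)) * indicator {0<..} x \<partial>lborel"
  assume "?I \<noteq> \<infinity>"
  then obtain r where r: "?I = ennreal r" "0 \<le> r"
    by (cases ?I) auto
  have "exp (- b) * ln c \<le> r" if "1 \<le> c" for c
  proof -
    have "((\<lambda>x. exp (- b) / x) has_integral (exp (- b) * ln c - exp (- b) * ln 1)) {1..c}"
      using that
      by (intro fundamental_theorem_of_calculus)
         (auto intro!: derivative_eq_intros simp: has_real_derivative_iff_has_vector_derivative[symmetric])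
    then have "ennreal (exp (- b) * ln c) = (\<integral>\<^sup>+x. ennreal (exp (- b) / x) * indicator {1..c} x \<partial>lborel)"
      by (subst nn_integral_has_integral_lebesgue'[of "{1..c}"]) auto
    also have "\<dots> \<le> ?I"
    proof (rule nn_integral_mono)
      fix x :: real
      have "exp (- b) / x \<le> x powr (- a - 1) * exp (- b / x)" if "1 \<le> x"
      proof -
        have "1 / x \<le> x powr (- a - 1)"
          using that assms powr_mono[of "-1" "- a - 1" x] by (simp add: powr_minus_divide)
        moreover have "exp (- b) \<le> exp (- b / x)"
          using that assms by (simp add: field_simps)
        ultimately have "1 / x * exp (- b) \<le> x powr (- a - 1) * exp (- b / x)"
          by (intro mult_mono) auto
        then show ?thesis by simp
      qed
      then show "ennreal (exp (- b) / x) * indicator {1..c} x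
          \<le> ennreal (x powr (- a - 1) * exp (- b / x)) * indicator {0<..} x"
        by (auto simp: indicator_def intro: ennreal_leI)
    qed
    finally show ?thesis using r by simp
  qed
  \<comment> \<open>This endpoint makes the lower bound equal to \<open>r + 1\<close>.\<close>
  from this[of "exp ((r + 1) / exp (- b))"] r show False
    by (auto simp: field_simps)
qed

section \<open>Inversion of lower-triangular matrices preserves the measure\<close>

lemma
  fixes A :: "'n::finite sq_matrix"
  assumes "invertible A"
  shows mult_matrix_inv: "A ** matrix_inv A = mat 1"
    and matrix_inv_mult: "matrix_inv A ** A = mat 1"
  using someI_ex[OF assms[unfolded invertible_def]] by (auto simp: matrix_inv_def)

text \<open>At the first nonzero coordinate \<open>k\<close> of a kernel vector, row
  \<open>k\<close> of \<open>L\<close> reads off exactly that coordinate, which must therefore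
  vanish.\<close>

lemma unit_lower_triangular_invertible:
  assumes "unit_lower_triangular L"
  shows "invertible L"
proof -
  have "x = 0" if x: "L *v x = 0" for x
  proof (rule ccontr)
    assume "x \<noteq> 0"
    define k where "k = Min {i. x $ i \<noteq> 0}"
    have ne: "{i. x $ i \<noteq> 0} \<noteq> {}" using \<open>x \<noteq> 0\<close> by (auto simp: vec_eq_iff)
    then have k: "x $ k \<noteq> 0" using Min_in[of "{i. x $ i \<noteq> 0}"] by (simp add: k_def)
    have less: "x $ i = 0" if "i < k" for i
      using that Min_le[of "{i. x $ i \<noteq> 0}" i] by (auto simp: k_def not_le[symmetric])
    have "(L *v x) $ k = (\<Sum>j\<in>UNIV. L $ k $ j * x $ j)"
      by (simp add: matrix_vector_mult_def)
    also have "\<dots> = (\<Sum>j\<in>{k}. L $ k $ j * x $ j)"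
    proof (rule sum.mono_neutral_right)
      show "\<forall>j\<in>UNIV - {k}. L $ k $ j * x $ j = 0"
        using assms less by (auto simp: unit_lower_triangular_def neq_iff)
    qed auto
    also have "\<dots> = x $ k" using assms by (simp add: unit_lower_triangular_def)
    finally show False using x k by simp
  qed
  then show ?thesis
    by (metis matrix_left_invertible_ker invertible_left_inverse)
qed

section \<open>Free coordinates and zero patterns\<close>

lemma L_of_in_L_G: "L_of E l \<in> L_G E"
  by (auto simp: L_G_def unit_lower_triangular_def L_of_def lower_edges_def)

lemma D_of_pos_diagonal: "pos_diagonal (D_of d) \<longleftrightarrow> (\<forall>i. 0 < d i)"
  by (simp add: pos_diagonal_def D_of_def)

lemma Theta_G_iff: "(L_of E l, D_of d) \<in> Theta_G E \<longleftrightarrow> (\<forall>i. 0 < d i)"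
  by (simp add: Theta_G_def L_of_in_L_G D_of_pos_diagonal)

lemma L_G_entries:
  assumes "T \<in> L_G E"
  shows "T $ i $ i = 1" "i < j \<Longrightarrow> T $ i $ j = 0" "j < i \<Longrightarrow> (i, j) \<notin> E \<Longrightarrow> T $ i $ j = 0"
  using assms by (auto simp: L_G_def unit_lower_triangular_def)

text \<open>Forward substitution: in entry \<open>(i, j)\<close> of \<open>L ** T\<close> only
  \<open>k\<close> from \<open>j\<close> to \<open>i\<close> contribute, and the unit diagonals
  isolate \<open>T $ i $ j\<close> and \<open>L $ i $ j\<close> at the two ends.\<close>

lemma lower_unitriangular_inverse_entry:
  fixes L T :: "'n::{finite,linorder} sq_matrix"
  assumes L: "unit_lower_triangular L" and T: "unit_lower_triangular T"
    and LT: "L ** T = mat 1" and "j < i"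
  shows "T $ i $ j = - (\<Sum>k\<in>{k. j < k \<and> k < i}. L $ i $ k * T $ k $ j) - L $ i $ j"
proof -
  let ?K = "{k. j < k \<and> k < i}"
  have "0 = (L ** T) $ i $ j" using LT \<open>j < i\<close> by (simp add: mat_def)
  also have "\<dots> = (\<Sum>k\<in>UNIV. L $ i $ k * T $ k $ j)"
    by (simp add: matrix_matrix_mult_def)
  also have "\<dots> = (\<Sum>k\<in>insert i (insert j ?K). L $ i $ k * T $ k $ j)"
  proof (rule sum.mono_neutral_right)
    show "\<forall>k\<in>UNIV - insert i (insert j ?K). L $ i $ k * T $ k $ j = 0"
    proof
      fix k assume "k \<in> UNIV - insert i (insert j ?K)"
      then have "i < k \<or> k < j" by auto
      then show "L $ i $ k * T $ k $ j = 0"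
        using L T by (auto simp: unit_lower_triangular_def)
    qed
  qed auto
  also have "\<dots> = T $ i $ j + (L $ i $ j + (\<Sum>k\<in>?K. L $ i $ k * T $ k $ j))"
    using \<open>j < i\<close> L T by (simp add: unit_lower_triangular_def)
  finally show ?thesis by simp
qed

text \<open>
  Overwriting the coordinates of \<open>L\<close> by those of its inverse one edge at a time, rows first and
  left to right within a row, turns the inversion into a composition of shears: the correction
  added at an edge involves only entries that already, respectively still, have the required value.
\<close>

definition lex_closed :: "('n::linorder \<times> 'n) set \<Rightarrow> ('n \<times> 'n) set \<Rightarrow> bool" where
  "lex_closed E A \<longleftrightarrow> A \<subseteq> lower_edges E \<and>
    (\<forall>(i, j)\<in>A. \<forall>(k, l)\<in>lower_edges E. k < i \<or> k = i \<and> l < j \<longrightarrow> (k, l) \<in> A)"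

definition partial_inverse ::
    "('n::{finite,linorder} \<times> 'n) set \<Rightarrow> ('n \<times> 'n) set \<Rightarrow> ('n \<times> 'n \<Rightarrow> real) \<Rightarrow> ('n \<times> 'n \<Rightarrow> real)" where
  "partial_inverse E A l =
     (\<lambda>e\<in>lower_edges E. if e \<in> A then matrix_inv (L_of E l) $ fst e $ snd e else l e)"

text \<open>One \<open>L_of E x\<close> serves both factors: when edge \<open>e\<close> is
  processed, \<open>x\<close> still holds \<open>L\<close> to the right of \<open>e\<close> in its
  row and already holds the inverse above \<open>e\<close> in its column.\<close>

definition inverse_correction ::
    "('n::{finite,linorder} \<times> 'n) set \<Rightarrow> 'n \<times> 'n \<Rightarrow> ('n \<times> 'n \<Rightarrow> real) \<Rightarrow> real" where
  "inverse_correction E e x =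
     - (\<Sum>k\<in>{k. snd e < k \<and> k < fst e}. L_of E x $ fst e $ k * L_of E x $ k $ snd e)"

text \<open>The edge removed is the lexicographically last one: the largest row, and in it the
  largest column.\<close>

lemma lex_closed_remove_last:
  assumes "lex_closed E A" "A \<noteq> {}" "finite A"
  obtains i j where "(i, j) \<in> A" "lex_closed E (A - {(i, j)})" "\<And>k. j < k \<Longrightarrow> (i, k) \<notin> A"
proof -
  define i where "i = Max (fst ` A)"
  define j where "j = Max {j. (i, j) \<in> A}"
  have fin: "finite {j. (i, j) \<in> A}"
    using finite_imageI[OF \<open>finite A\<close>, of snd] by (rule rev_finite_subset) force
  have "i \<in> fst ` A" using assms by (simp add: i_def)
  then have "{j. (i, j) \<in> A} \<noteq> {}" by auto
  with fin have ij: "(i, j) \<in> A" unfolding j_def using Max_in by blast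
  have imax: "k \<le> i" if "(k, l) \<in> A" for k l
    using that assms unfolding i_def by (intro Max_ge) force+
  have jmax: "k \<le> j" if "(i, k) \<in> A" for k
    using that fin unfolding j_def by (intro Max_ge) auto
  have "lex_closed E (A - {(i, j)})"
    using assms(1) imax jmax unfolding lex_closed_def by (fastforce simp: not_less[symmetric])
  moreover have "(i, k) \<notin> A" if "j < k" for k using jmax that leD by blast
  ultimately show thesis using that ij by blast
qed

text \<open>Forward substitution for the entry at \<open>(i, j)\<close>. The entries of row
  \<open>i\<close> right of \<open>j\<close> are not yet overwritten by the third assumption on
  \<open>A\<close>, and those in the rows above are overwritten because \<open>A\<close> is
  closed.\<close>

lemma partial_inverse_step:
  fixes E :: "('n::{finite,linorder} \<times> 'n) set" and l :: "'n \<times> 'n \<Rightarrow> real"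
  assumes inv: "\<And>l. matrix_inv (L_of E l) \<in> L_G E"
    and A: "lex_closed E A" "(i, j) \<in> A" "\<And>k. j < k \<Longrightarrow> (i, k) \<notin> A"
  defines "x \<equiv> partial_inverse E (A - {(i, j)}) l"
  shows "partial_inverse E A l = x((i, j) := inverse_correction E (i, j) x - x (i, j))"
proof -
  let ?L = "L_of E l" and ?T = "matrix_inv (L_of E l)"
  have ij: "(i, j) \<in> lower_edges E" "j < i"
    using A by (auto simp: lex_closed_def lower_edges_def)
  have L: "unit_lower_triangular ?L" and T: "unit_lower_triangular ?T"
    using inv[of l] L_of_in_L_G[of E l] by (auto simp: L_G_def)
  have "?L ** ?T = mat 1"
    using unit_lower_triangular_invertible[OF L] by (rule mult_matrix_inv)
  then have T_ij: "?T $ i $ j = - (\<Sum>k\<in>{k. j < k \<and> k < i}. ?L $ i $ k * ?T $ k $ j) - ?L $ i $ j"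
    using L T ij by (intro lower_unitriangular_inverse_entry)
  have "L_of E x $ i $ k * L_of E x $ k $ j = ?L $ i $ k * ?T $ k $ j" if k: "j < k" "k < i" for k
  proof -
    have "L_of E x $ i $ k = ?L $ i $ k"
      using A(3)[OF k(1)] by (auto simp: L_of_def x_def partial_inverse_def)
    moreover have "L_of E x $ k $ j = ?T $ k $ j"
    proof (cases "(k, j) \<in> lower_edges E")
      case True
      then have "(k, j) \<in> A" using A(1,2) k(2) by (auto simp: lex_closed_def)
      with True k show ?thesis by (auto simp: L_of_def x_def partial_inverse_def)
    next
      \<comment> \<open>At a non-edge \<open>L_of\<close> reads 0, which is correct because the
        inverse has the zero pattern of the graph as well.\<close>
      case False
      with k L_G_entries(3)[OF inv[of l], of j k] show ?thesis
        by (auto simp: L_of_def lower_edges_def)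
    qed
    ultimately show ?thesis by simp
  qed
  then have "inverse_correction E (i, j) x = - (\<Sum>k\<in>{k. j < k \<and> k < i}. ?L $ i $ k * ?T $ k $ j)"
    by (simp add: inverse_correction_def)
  moreover have "x (i, j) = ?L $ i $ j"
    using ij by (auto simp: x_def partial_inverse_def L_of_def)
  ultimately have "?T $ i $ j = inverse_correction E (i, j) x - x (i, j)"
    using T_ij by simp
  then show ?thesis
    using A(2) ij by (auto simp: fun_eq_iff x_def partial_inverse_def)
qed

lemma measurable_L_of_nth [measurable]:
  "(\<lambda>x. L_of E x $ a $ b) \<in> borel_measurable (PiM (lower_edges E) (\<lambda>_. lborel))"
  using measurable_component_singleton[of "(a, b)" "lower_edges E" "\<lambda>_. lborel"]
  by (cases "a = b"; cases "(a, b) \<in> lower_edges E") (auto simp: L_of_def)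

lemma distr_partial_inverse:
  fixes E :: "('n::{finite,linorder} \<times> 'n) set"
  assumes inv: "\<And>l. matrix_inv (L_of E l) \<in> L_G E" and "lex_closed E A"
  defines "M \<equiv> PiM (lower_edges E) (\<lambda>_. lborel)"
  shows "partial_inverse E A \<in> M \<rightarrow>\<^sub>M M \<and> distr M M (partial_inverse E A) = M"
proof -
  have "finite A" by simp
  then show ?thesis
    using \<open>lex_closed E A\<close>
  proof (induction A rule: finite_remove_induct)
    case empty
    have "partial_inverse E {} l = l" if "l \<in> space M" for l
      using that by (auto simp: partial_inverse_def M_def space_PiM PiE_def extensional_restrict)
    then show ?case
      using measurable_cong[of M "partial_inverse E {}" "\<lambda>x. x" M]
        distr_cong[of M M M M "partial_inverse E {}" "\<lambda>x. x"] by (simp add: distr_id2)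
  next
    case (remove A)
    obtain i j where ij: "(i, j) \<in> A" "lex_closed E (A - {(i, j)})" "\<And>k. j < k \<Longrightarrow> (i, k) \<notin> A"
      using lex_closed_remove_last[OF remove.prems remove.hyps(2,1)] by blast
    let ?P = "partial_inverse E (A - {(i, j)})"
    define s where "s = (\<lambda>x. x((i, j) := inverse_correction E (i, j) x - x (i, j)))"
    have eq: "partial_inverse E A = s \<circ> ?P"
      using partial_inverse_step[OF inv remove.prems ij(1,3)] by (simp add: fun_eq_iff s_def)
    have mem: "(i, j) \<in> lower_edges E" using ij(1) remove.prems by (auto simp: lex_closed_def)
    have corr: "inverse_correction E (i, j) \<in> borel_measurable (PiM (lower_edges E) (\<lambda>_. lborel))"
      unfolding inverse_correction_def by measurable
    \<comment> \<open>The sum runs over \<open>k\<close> strictly between \<open>j\<close> and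
      \<open>i\<close>, so neither \<open>(i, k)\<close> nor \<open>(k, j)\<close> is the edge
      \<open>(i, j)\<close>.\<close>
    have indep: "inverse_correction E (i, j) (x((i, j) := c)) = inverse_correction E (i, j) x" for x c
      unfolding inverse_correction_def by (auto simp: L_of_def intro!: sum.cong)
    have s: "s \<in> M \<rightarrow>\<^sub>M M" "distr M M s = M"
      unfolding s_def M_def
      using measurable_shear[OF _ mem corr indep] distr_shear[OF _ mem corr indep] by auto
    have P: "?P \<in> M \<rightarrow>\<^sub>M M" "distr M M ?P = M"
      using remove.IH[OF ij(1,2)] by auto
    show ?case
      unfolding eq using measurable_comp[OF P(1) s(1)] distr_distr[OF s(1) P(1)] s(2) P(2) by (simp add: comp_def)
  qed
qed

section \<open>The integral as a product over rows\<close>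

lemma matrix_inv_eqI:
  fixes A B :: "'n::finite sq_matrix"
  assumes "A ** B = mat 1"
  shows "matrix_inv A = B"
proof -
  have "invertible A" using assms invertible_right_inverse by blast
  then have "matrix_inv A ** A = mat 1" by (rule matrix_inv_mult)
  then show ?thesis by (metis assms matrix_mul_assoc matrix_mul_lid matrix_mul_rid)
qed

text \<open>With \<open>T\<close> the inverse of \<open>L\<close>, the inverse of
  \<open>L ** D ** transpose L\<close> is \<open>transpose T ** R ** T\<close>, where
  \<open>R\<close> inverts \<open>D\<close>. Cyclicity of the trace leaves the diagonal of
  \<open>T ** U ** transpose T\<close>, weighted by \<open>R\<close>; these entries are the form of
  \<open>U\<close> at the rows of \<open>T\<close>.\<close>

lemma z_integrand_eq_prod:
  fixes L :: "'n::finite sq_matrix"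
  assumes "invertible L" "pos_diagonal D"
  shows "z_integrand U \<alpha> L D =
    (\<Prod>i\<in>UNIV. exp (- (matrix_inv L $ i \<bullet> (U *v matrix_inv L $ i) / D $ i $ i) / 2) * D $ i $ i powr (- \<alpha> $ i / 2))"
proof -
  define T where "T = matrix_inv L"
  have LT: "L ** T = mat 1" "T ** L = mat 1"
    using assms by (simp_all add: T_def mult_matrix_inv matrix_inv_mult)
  have d: "0 < D $ i $ i" and D0: "i \<noteq> j \<Longrightarrow> D $ i $ j = 0" for i j
    using assms by (auto simp: pos_diagonal_def)
  define R :: "'n sq_matrix" where "R = (\<chi> i j. if i = j then 1 / D $ i $ i else 0)"
  have DR: "D ** R = mat 1"
  proof -
    have "(D ** R) $ i $ j = (mat 1 :: 'n sq_matrix) $ i $ j" for i j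
    proof -
      have "(D ** R) $ i $ j = D $ i $ j * (1 / D $ j $ j)"
        by (simp add: matrix_matrix_mult_def R_def if_distrib cong: if_cong)
      then show ?thesis using d[of i] D0[of i j] by (cases "i = j") (auto simp: mat_def)
    qed
    then show ?thesis by (simp add: vec_eq_iff)
  qed
  have LTt: "transpose L ** transpose T = mat 1"
    using LT(2) by (metis matrix_transpose_mul transpose_mat)
  have "(L ** D ** transpose L) ** (transpose T ** R ** T)
      = L ** (D ** ((transpose L ** transpose T) ** R)) ** T"
    by (simp only: matrix_mul_assoc)
  also have "\<dots> = mat 1" by (simp add: LTt DR LT)
  finally have "matrix_inv (L ** D ** transpose L) = transpose T ** R ** T"
    by (rule matrix_inv_eqI)
  then have "trace (matrix_inv (L ** D ** transpose L) ** U) = trace (transpose T ** (R ** T ** U))"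
    by (simp only: matrix_mul_assoc)
  also have "\<dots> = trace ((R ** T ** U) ** transpose T)" by (rule trace_mul_sym)
  also have "\<dots> = trace (R ** (T ** U ** transpose T))" by (simp only: matrix_mul_assoc)
  also have "\<dots> = (\<Sum>i\<in>UNIV. (T ** U ** transpose T) $ i $ i / D $ i $ i)"
    by (simp add: trace_def matrix_matrix_mult_def R_def if_distrib[of "\<lambda>c. c * _"] cong: if_cong)
  also have "\<dots> = (\<Sum>i\<in>UNIV. T $ i \<bullet> (U *v T $ i) / D $ i $ i)"
  proof -
    have "(T ** U ** transpose T) $ i $ i = T $ i \<bullet> (U *v T $ i)" for i
    proof -
      have "(T ** U ** transpose T) $ i $ i = (T ** (U ** transpose T)) $ i $ i"
        by (simp only: matrix_mul_assoc)
      also have "\<dots> = T $ i \<bullet> (U *v T $ i)"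
        by (simp add: matrix_matrix_mult_def matrix_vector_mult_def transpose_def inner_vec_def)
      finally show ?thesis .
    qed
    then show ?thesis by simp
  qed
  finally have tr: "trace (matrix_inv (L ** D ** transpose L) ** U)
      = (\<Sum>i\<in>UNIV. T $ i \<bullet> (U *v T $ i) / D $ i $ i)" .
  have "z_integrand U \<alpha> L D = exp (\<Sum>i\<in>UNIV. - (T $ i \<bullet> (U *v T $ i) / D $ i $ i) / 2 + (- \<alpha> $ i / 2) * ln (D $ i $ i))"
    unfolding z_integrand_def tr
    by (simp add: sum_distrib_left sum_negf[symmetric] sum.distrib[symmetric] sum_divide_distrib add_divide_distrib
        del: sum.distrib)
  also have "\<dots> = (\<Prod>i\<in>UNIV. exp (- (T $ i \<bullet> (U *v T $ i) / D $ i $ i) / 2) * D $ i $ i powr (- \<alpha> $ i / 2))"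
  proof -
    have "exp (x + c * ln (D $ i $ i)) = exp x * D $ i $ i powr c" for x c i
      using d[of i] by (simp add: exp_add powr_def)
    then show ?thesis by (simp only: exp_sum finite)
  qed
  finally show ?thesis by (simp add: T_def)
qed

text \<open>The factor of the integrand belonging to row \<open>i\<close> of the inverse and the
  diagonal entry \<open>c\<close> of \<open>D\<close>. The value 0 for \<open>c \<le> 0\<close>
  absorbs the restriction of the integral to \<open>Theta_G\<close>.\<close>

definition row_density :: "('n::{finite,linorder} \<times> 'n) set \<Rightarrow> 'n sq_matrix \<Rightarrow> (real, 'n) vec \<Rightarrow> 'n \<Rightarrow>
    ('n \<times> 'n \<Rightarrow> real) \<Rightarrow> real \<Rightarrow> ennreal" where
  "row_density E U \<alpha> i l c =
     (let v = axis i 1 + row_vec i (pred_nbhd E i) l in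
      if 0 < c then ennreal (exp (- (v \<bullet> (U *v v) / c) / 2) * c powr (- \<alpha> $ i / 2)) else 0)"

lemma lower_edges_eq_UN: "lower_edges E = (\<Union>i\<in>UNIV. {i} \<times> pred_nbhd E i)"
  by (auto simp: lower_edges_def pred_nbhd_def)

text \<open>Arbitrary \<open>f\<close> and \<open>g\<close> cover joint measurability on product
  spaces as well as the sections with \<open>l\<close> or \<open>c\<close> fixed.\<close>

lemma measurable_row_density [measurable (raw)]:
  fixes E :: "('n::{finite,linorder} \<times> 'n) set"
  assumes "{i} \<times> pred_nbhd E i \<subseteq> I"
    and f[measurable]: "f \<in> N \<rightarrow>\<^sub>M PiM I (\<lambda>_. lborel)" and g[measurable]: "g \<in> borel_measurable N"
  shows "(\<lambda>x. row_density E U \<alpha> i (f x) (g x)) \<in> borel_measurable N"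
proof -
  define q where "q l = (axis i 1 + row_vec i (pred_nbhd E i) l) \<bullet> (U *v (axis i 1 + row_vec i (pred_nbhd E i) l))" for l
  have [measurable]: "q \<in> borel_measurable (PiM I (\<lambda>_. lborel))"
    unfolding q_def using assms(1) by (rule measurable_quadratic_form_row_vec)
  have "row_density E U \<alpha> i (f x) (g x) =
      (if 0 < g x then ennreal (exp (- (q (f x) / g x) / 2) * g x powr (- \<alpha> $ i / 2)) else 0)" for x
    by (simp add: row_density_def q_def Let_def)
  then show ?thesis by simp
qed

lemma matrix_inv_row:
  assumes "matrix_inv (L_of E l) \<in> L_G E"
  shows "matrix_inv (L_of E l) $ i =
    axis i 1 + row_vec i (pred_nbhd E i) (partial_inverse E (lower_edges E) l)"
proof -
  have "matrix_inv (L_of E l) $ i $ j =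
    (axis i 1 + row_vec i (pred_nbhd E i) (partial_inverse E (lower_edges E) l)) $ j" for j
    using L_G_entries(1)[OF assms, of i] L_G_entries(2)[OF assms, of i j] L_G_entries(3)[OF assms, of j i]
    by (cases i j rule: linorder_cases)
       (auto simp: axis_def row_vec_nth pred_nbhd_def partial_inverse_def lower_edges_def)
  then show ?thesis by (simp add: vec_eq_iff)
qed

lemma z_G_integrand:
  assumes "matrix_inv (L_of E l) \<in> L_G E"
  shows "ennreal (z_integrand U \<alpha> (L_of E l) (D_of d)) *
      indicator {(l, d). (L_of E l, D_of d) \<in> Theta_G E} (l, d)
    = (\<Prod>i\<in>UNIV. row_density E U \<alpha> i (partial_inverse E (lower_edges E) l) (d i))"
proof (cases "\<forall>i. 0 < d i")
  case True
  have "invertible (L_of E l)"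
    using L_of_in_L_G[of E l] by (intro unit_lower_triangular_invertible) (auto simp: L_G_def)
  moreover have "pos_diagonal (D_of d)" using True by (simp add: D_of_pos_diagonal)
  moreover have "D_of d $ i $ i = d i" for i by (simp add: D_of_def)
  ultimately show ?thesis
    using True
    by (simp add: Theta_G_iff z_integrand_eq_prod matrix_inv_row[OF assms] row_density_def
        Let_def prod_ennreal)
next
  case False
  then obtain i where i: "\<not> 0 < d i" by blast
  then have "row_density E U \<alpha> i (partial_inverse E (lower_edges E) l) (d i) = 0"
    by (simp add: row_density_def Let_def)
  then have 0: "(\<Prod>i\<in>UNIV. row_density E U \<alpha> i (partial_inverse E (lower_edges E) l) (d i)) = 0"
    by (intro prod_zero) auto
  have "(l, d) \<notin> {(l, d). (L_of E l, D_of d) \<in> Theta_G E}"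
    using i by (auto simp: Theta_G_iff)
  then show ?thesis unfolding 0 by simp
qed

text \<open>Inversion of \<open>L\<close> preserves the measure, so the integrand may be expressed
  in the entries of the inverse. It is then a product over disjoint blocks of coordinates, one per
  row, and Fubini separates these and the \<open>d i\<close>.\<close>

lemma z_G_eq_prod:
  fixes E :: "('n::{finite,linorder} \<times> 'n) set"
  assumes inv: "\<And>l. matrix_inv (L_of E l) \<in> L_G E"
  shows "z_G E U \<alpha> =
    (\<Prod>i\<in>UNIV. \<integral>\<^sup>+c. (\<integral>\<^sup>+l. row_density E U \<alpha> i l c \<partial>PiM ({i} \<times> pred_nbhd E i) (\<lambda>_. lborel)) \<partial>lborel)"
proof -
  define M :: "('n \<times> 'n \<Rightarrow> real) measure" where "M = PiM (lower_edges E) (\<lambda>_. lborel)"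
  define N :: "('n \<Rightarrow> real) measure" where "N = PiM UNIV (\<lambda>_. lborel)"
  define \<phi> where "\<phi> = partial_inverse E (lower_edges E)"
  let ?h = "row_density E U \<alpha>"
  interpret P: product_sigma_finite "\<lambda>_ :: 'n \<times> 'n. lborel :: real measure"
    by (rule product_sigma_finite_lborel)
  interpret Q: product_sigma_finite "\<lambda>_ :: 'n. lborel :: real measure"
    by (rule product_sigma_finite_lborel)
  interpret pair_sigma_finite M N
    unfolding pair_sigma_finite_def M_def N_def using P.sigma_finite Q.sigma_finite by simp
  have "lex_closed E (lower_edges E)" by (auto simp: lex_closed_def)
  then have \<phi>[measurable]: "\<phi> \<in> M \<rightarrow>\<^sub>M M" and distr: "distr M M \<phi> = M"
    using distr_partial_inverse[OF inv] by (auto simp: \<phi>_def M_def)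
  have sub: "{i} \<times> pred_nbhd E i \<subseteq> lower_edges E" for i by (auto simp: lower_edges_eq_UN)
  have comp[measurable]: "(\<lambda>d. d i) \<in> borel_measurable N" for i unfolding N_def by simp
  have h: "(\<lambda>x. ?h i (f x) (g x)) \<in> borel_measurable K"
    if "f \<in> K \<rightarrow>\<^sub>M M" "g \<in> borel_measurable K" for i f g and K :: "'z measure"
    using measurable_row_density[OF sub that(1)[unfolded M_def] that(2)] .
  have "z_G E U \<alpha> = (\<integral>\<^sup>+x. (\<Prod>i\<in>UNIV. ?h i (\<phi> (fst x)) (snd x i)) \<partial>(M \<Otimes>\<^sub>M N))"
    unfolding z_G_def dL_dD_def M_def[symmetric] N_def[symmetric]
  proof (rule nn_integral_cong)
    fix x :: "('n \<times> 'n \<Rightarrow> real) \<times> ('n \<Rightarrow> real)"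
    show "ennreal (z_integrand U \<alpha> (L_of E (fst x)) (D_of (snd x))) *
        indicator {(l, d). (L_of E l, D_of d) \<in> Theta_G E} x
      = (\<Prod>i\<in>UNIV. ?h i (\<phi> (fst x)) (snd x i))"
      using z_G_integrand[OF inv, of U \<alpha> "fst x" "snd x"] by (simp add: \<phi>_def)
  qed
  \<comment> \<open>With \<open>d\<close> outermost, the inversion can be removed from the inner
    integral for each fixed \<open>d\<close>.\<close>
  also have "\<dots> = (\<integral>\<^sup>+d. (\<integral>\<^sup>+l. (\<Prod>i\<in>UNIV. ?h i (\<phi> l) (d i)) \<partial>M) \<partial>N)"
    by (subst nn_integral_snd[symmetric])
       (auto simp: split_beta' intro!: borel_measurable_prod_ennreal h)
  also have "\<dots> = (\<integral>\<^sup>+d. (\<Prod>i\<in>UNIV. \<integral>\<^sup>+l. ?h i l (d i) \<partial>PiM ({i} \<times> pred_nbhd E i) (\<lambda>_. lborel)) \<partial>N)"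
  proof (rule nn_integral_cong)
    fix d :: "'n \<Rightarrow> real"
    have "(\<integral>\<^sup>+l. (\<Prod>i\<in>UNIV. ?h i (\<phi> l) (d i)) \<partial>M) = (\<integral>\<^sup>+l. (\<Prod>i\<in>UNIV. ?h i l (d i)) \<partial>distr M M \<phi>)"
      by (rule nn_integral_distr[symmetric]) (auto intro!: borel_measurable_prod_ennreal h)
    also have "\<dots> = (\<integral>\<^sup>+l. (\<Prod>i\<in>UNIV. ?h i l (d i)) \<partial>PiM (\<Union>i\<in>UNIV. {i} \<times> pred_nbhd E i) (\<lambda>_. lborel))"
      by (simp only: distr) (simp add: M_def lower_edges_eq_UN)
    also have "\<dots> = (\<Prod>i\<in>UNIV. \<integral>\<^sup>+l. ?h i l (d i) \<partial>PiM ({i} \<times> pred_nbhd E i) (\<lambda>_. lborel))"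
    proof (rule nn_integral_PiM_prod_blocks)
      show "disjoint_family_on (\<lambda>i. {i} \<times> pred_nbhd E i) UNIV"
        by (auto simp: disjoint_family_on_def)
      show "(\<lambda>l. ?h i l (d i)) \<in> borel_measurable (PiM I (\<lambda>_. lborel))"
        if "{i} \<times> pred_nbhd E i \<subseteq> I" for i I
        using that by (rule measurable_row_density) auto
      show "?h i x (d i) = ?h i y (d i)" if "\<And>b. b \<in> {i} \<times> pred_nbhd E i \<Longrightarrow> x b = y b" for i x y
      proof -
        have "row_vec i (pred_nbhd E i) x = row_vec i (pred_nbhd E i) y"
          using that by (auto simp: vec_eq_iff row_vec_nth)
        then show ?thesis by (simp add: row_density_def)
      qed
    qed auto
    finally show "(\<integral>\<^sup>+l. (\<Prod>i\<in>UNIV. ?h i (\<phi> l) (d i)) \<partial>M)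
      = (\<Prod>i\<in>UNIV. \<integral>\<^sup>+l. ?h i l (d i) \<partial>PiM ({i} \<times> pred_nbhd E i) (\<lambda>_. lborel))" .
  qed
  also have "\<dots> = (\<Prod>i\<in>UNIV. \<integral>\<^sup>+c. (\<integral>\<^sup>+l. ?h i l c \<partial>PiM ({i} \<times> pred_nbhd E i) (\<lambda>_. lborel)) \<partial>lborel)"
    unfolding N_def
  proof (rule Q.product_nn_integral_prod)
    fix i :: 'n
    interpret S: sigma_finite_measure "PiM ({i} \<times> pred_nbhd E i) (\<lambda>_. lborel :: real measure)"
      by (rule product_sigma_finite.sigma_finite[OF product_sigma_finite_lborel]) simp
    show "(\<lambda>c. \<integral>\<^sup>+l. ?h i l c \<partial>PiM ({i} \<times> pred_nbhd E i) (\<lambda>_. lborel)) \<in> borel_measurable lborel"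
      by (rule S.borel_measurable_nn_integral)
         (auto simp: split_beta' intro!: measurable_row_density[of i E "{i} \<times> pred_nbhd E i"])
  qed simp
  finally show ?thesis .
qed

text \<open>The Gaussian integral over the row leaves an inverse gamma integral with shape
  \<open>a\<close> and scale \<open>b\<close>, half the Schur complement. The shape is positive
  exactly when \<open>p i + 2 < \<alpha> $ i\<close>.\<close>

lemma nn_integral_row_density:
  fixes E :: "('n::{finite,linorder} \<times> 'n) set"
  assumes U: "pos_def U"
  defines "S \<equiv> \<lambda>i. pred_nbhd E i"
  defines "p \<equiv> \<lambda>i. real (card (S i))"
  shows "(\<integral>\<^sup>+c. (\<integral>\<^sup>+l. row_density E U \<alpha> i l c \<partial>PiM ({i} \<times> S i) (\<lambda>_. lborel)) \<partial>lborel)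
    = (if p i + 2 < \<alpha> $ i then
        ennreal (Gamma (\<alpha> $ i / 2 - p i / 2 - 1) * 2 powr (\<alpha> $ i / 2 - 1) * sqrt pi ^ card (S i)
          * principal_det U (S i) powr (\<alpha> $ i / 2 - p i / 2 - 3 / 2)
          / principal_det U (S i \<union> {i}) powr (\<alpha> $ i / 2 - p i / 2 - 1))
      else \<infinity>)"
proof -
  define P where "P = principal_det U (S i)"
  define R where "R = principal_det U (insert i (S i))"
  define a where "a = \<alpha> $ i / 2 - p i / 2 - 1"
  define b where "b = R / P / 2"
  define C where "C = sqrt (2 * pi) ^ card (S i) / sqrt P"
  have pos: "0 < P" "0 < R" using principal_det_pos[OF U] by (auto simp: P_def R_def)
  then have b: "0 < b" and C: "0 < C" by (auto simp: b_def C_def)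
  have i: "i \<notin> S i" by (simp add: S_def pred_nbhd_def)
  obtain w where w: "\<And>j. j \<notin> S i \<Longrightarrow> w $ j = 0" "\<And>j. j \<in> S i \<Longrightarrow> (U *v (axis i 1 + w)) $ j = 0"
    using pos_def_orthogonal_extension[OF U] by blast
  define z where "z = axis i 1 + w"
  have z: "z \<bullet> (U *v z) = 2 * b"
    using principal_det_insert[OF U i w] pos by (simp add: z_def b_def P_def R_def field_simps)
  have inner: "(\<integral>\<^sup>+l. row_density E U \<alpha> i l c \<partial>PiM ({i} \<times> S i) (\<lambda>_. lborel))
      = ennreal C * (ennreal (c powr (- a - 1) * exp (- b / c)) * indicator {0<..} c)" for c
  proof (cases "0 < c")
    case True
    \<comment> \<open>Here \<open>z - w\<close> is \<open>axis i 1\<close>, so \<open>?v l\<close>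
      is the row with unit diagonal entry, written around the critical point
      \<open>z\<close>.\<close>
    let ?v = "\<lambda>l. z - w + row_vec i (S i) l"
    have "(\<integral>\<^sup>+l. row_density E U \<alpha> i l c \<partial>PiM ({i} \<times> S i) (\<lambda>_. lborel))
      = (\<integral>\<^sup>+l. ennreal (c powr (- \<alpha> $ i / 2)) * ennreal (exp (- (?v l \<bullet> (U *v ?v l) / c) / 2)) \<partial>PiM ({i} \<times> S i) (\<lambda>_. lborel))"
      using True by (intro nn_integral_cong)
        (simp add: row_density_def Let_def z_def S_def ennreal_mult'[symmetric] mult.commute)
    also have "\<dots> = ennreal (c powr (- \<alpha> $ i / 2)) *
        (\<integral>\<^sup>+l. ennreal (exp (- (?v l \<bullet> (U *v ?v l) / c) / 2)) \<partial>PiM ({i} \<times> S i) (\<lambda>_. lborel))"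
      using measurable_quadratic_form_row_vec[of i "S i" "{i} \<times> S i" "z - w" U, measurable]
      by (intro nn_integral_cmult) measurable
    also have "\<dots> = ennreal (c powr (- \<alpha> $ i / 2)) *
        ennreal (exp (- (z \<bullet> (U *v z) / c) / 2) * (sqrt (2 * pi * c) ^ card (S i) / sqrt (principal_det U (S i))))"
      by (subst nn_integral_gaussian_row[OF U True]) (use w in \<open>auto simp: z_def\<close>)
    also have "\<dots> = ennreal (c powr (- \<alpha> $ i / 2) *
        (exp (- (z \<bullet> (U *v z) / c) / 2) * (sqrt (2 * pi * c) ^ card (S i) / sqrt (principal_det U (S i)))))"
      by (rule ennreal_mult'[symmetric]) simp
    also have "c powr (- \<alpha> $ i / 2) * (exp (- (z \<bullet> (U *v z) / c) / 2) * (sqrt (2 * pi * c) ^ card (S i) / sqrt (principal_det U (S i))))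
        = C * (c powr (- a - 1) * exp (- b / c))"
    proof -
      \<comment> \<open>The Gaussian integral contributes \<open>sqrt c\<close> for each free entry,
        which raises the exponent \<open>- \<alpha> $ i / 2\<close> to
        \<open>- a - 1\<close>.\<close>
      have "sqrt c ^ card (S i) = c powr (p i / 2)"
        using True by (simp add: powr_half_sqrt[symmetric] powr_realpow[symmetric] powr_powr p_def)
      moreover have "- a - 1 = - \<alpha> $ i / 2 + p i / 2" by (simp add: a_def)
      ultimately have "c powr (- a - 1) = c powr (- \<alpha> $ i / 2) * sqrt c ^ card (S i)"
        by (simp only: powr_add)
      then show ?thesis
        by (simp add: z C_def P_def real_sqrt_mult power_mult_distrib)
    qed
    finally show ?thesis
      using True C by (simp add: ennreal_mult')
  next
    case False
    then show ?thesis by (simp add: row_density_def Let_def)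
  qed
  have "(\<integral>\<^sup>+c. (\<integral>\<^sup>+l. row_density E U \<alpha> i l c \<partial>PiM ({i} \<times> S i) (\<lambda>_. lborel)) \<partial>lborel)
    = ennreal C * (\<integral>\<^sup>+c. ennreal (c powr (- a - 1) * exp (- b / c)) * indicator {0<..} c \<partial>lborel)"
    unfolding inner by (rule nn_integral_cmult) measurable
  also have "\<dots> = (if p i + 2 < \<alpha> $ i then
      ennreal (Gamma a * 2 powr (\<alpha> $ i / 2 - 1) * sqrt pi ^ card (S i) * P powr (a - 1 / 2) / R powr a) else \<infinity>)"
  proof (cases "p i + 2 < \<alpha> $ i")
    case True
    then have a: "0 < a" by (simp add: a_def)
    \<comment> \<open>The powers of 2 come from the Gaussian constant \<open>C\<close> and from the
      halving in \<open>b\<close>. Likewise \<open>P\<close> occurs in \<open>b\<close> and, under a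
      square root, in \<open>C\<close>, whence its exponent \<open>a - 1 / 2\<close>.\<close>
    have "sqrt 2 ^ card (S i) = 2 powr (p i / 2)"
      by (simp add: powr_half_sqrt[symmetric] powr_realpow[symmetric] powr_powr p_def)
    moreover have "\<alpha> $ i / 2 - 1 = p i / 2 + a" by (simp add: a_def)
    ultimately have 2: "2 powr (\<alpha> $ i / 2 - 1) = sqrt 2 ^ card (S i) * 2 powr a"
      by (simp only: powr_add)
    have P: "P powr (a - 1 / 2) = P powr a / sqrt P"
      using pos by (simp add: powr_diff powr_half_sqrt)
    have "C * (Gamma a / b powr a) =
      Gamma a * 2 powr (\<alpha> $ i / 2 - 1) * sqrt pi ^ card (S i) * P powr (a - 1 / 2) / R powr a"
      unfolding 2 P using pos
      by (simp add: C_def b_def real_sqrt_mult power_mult_distrib powr_divide powr_mult)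
    then show ?thesis
      unfolding nn_integral_inverse_gamma[OF a b] using True C by (simp add: ennreal_mult'[symmetric])
  next
    case False
    then have "a \<le> 0" by (simp add: a_def)
    then show ?thesis
      unfolding nn_integral_inverse_gamma_infinite[OF \<open>a \<le> 0\<close> b] using False C by (simp add: ennreal_mult_top)
  qed
  finally show ?thesis
    by (simp add: a_def P_def R_def)
qed

section \<open>Finiteness criterion and closed form\<close>

theorem corollary3:
  fixes E :: "('n::{finite,linorder} \<times> 'n) set"
    and U :: "'n sq_matrix"
    and \<alpha> :: "(real, 'n) vec"
  assumes "graph E"
    and "homogeneous E"
    and "S_H E"
    and "pos_def U"
    and "\<And>i. 0 \<le> \<alpha> $ i"
  shows "(z_G E U \<alpha> < \<infinity> \<longleftrightarrow> (\<forall>i. \<alpha> $ i > real (card (pred_nbhd E i)) + 2)) \<and>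
    (z_G E U \<alpha> < \<infinity> \<longrightarrow>
      enn2real (z_G E U \<alpha>) =
        (\<Prod>i\<in>UNIV.
           Gamma (\<alpha> $ i / 2 - real (card (pred_nbhd E i)) / 2 - 1)
           * 2 powr (\<alpha> $ i / 2 - 1)
           * sqrt pi ^ card (pred_nbhd E i)
           * principal_det U (pred_nbhd E i)
               powr (\<alpha> $ i / 2 - real (card (pred_nbhd E i)) / 2 - 3 / 2)
           / principal_det U (pred_nbhd E i \<union> {i})
               powr (\<alpha> $ i / 2 - real (card (pred_nbhd E i)) / 2 - 1)))"
proof -
  let ?F = "\<lambda>i. Gamma (\<alpha> $ i / 2 - real (card (pred_nbhd E i)) / 2 - 1)
           * 2 powr (\<alpha> $ i / 2 - 1)
           * sqrt pi ^ card (pred_nbhd E i)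
           * principal_det U (pred_nbhd E i)
               powr (\<alpha> $ i / 2 - real (card (pred_nbhd E i)) / 2 - 3 / 2)
           / principal_det U (pred_nbhd E i \<union> {i})
               powr (\<alpha> $ i / 2 - real (card (pred_nbhd E i)) / 2 - 1)"
  let ?ok = "\<lambda>i. real (card (pred_nbhd E i)) + 2 < \<alpha> $ i"
  \<comment> \<open>This is the second clause of \<open>S_H\<close>.\<close>
  have "matrix_inv (L_of E l) \<in> L_G E" for l
    using \<open>S_H E\<close> L_of_in_L_G[of E l] by (auto simp: S_H_def L_G_def)
  then have z: "z_G E U \<alpha> = (\<Prod>i\<in>UNIV. if ?ok i then ennreal (?F i) else \<infinity>)"
    by (simp only: z_G_eq_prod nn_integral_row_density[OF \<open>pos_def U\<close>])
  \<comment> \<open>Strict positivity matters for divergence: in \<open>ennreal\<close> a factor 0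
    would annihilate an infinite one.\<close>
  have pos: "0 < ?F i" if "?ok i" for i
    using that principal_det_pos[OF \<open>pos_def U\<close>, of "pred_nbhd E i"]
      principal_det_pos[OF \<open>pos_def U\<close>, of "pred_nbhd E i \<union> {i}"]
    by (intro divide_pos_pos mult_pos_pos Gamma_real_pos) auto
  show ?thesis
  proof (cases "\<forall>i. ?ok i")
    case True
    then have "z_G E U \<alpha> = ennreal (\<Prod>i\<in>UNIV. ?F i)"
      using pos by (simp add: z prod_ennreal less_imp_le)
    moreover have "0 \<le> (\<Prod>i\<in>UNIV. ?F i)"
      using pos True by (intro prod_nonneg) (auto intro: less_imp_le)
    ultimately show ?thesis using True by simp
  next
    case False
    then obtain i where i: "\<not> ?ok i" by blast
    have "z_G E U \<alpha> = \<infinity> * (\<Prod>i\<in>UNIV - {i}. if ?ok i then ennreal (?F i) else \<infinity>)"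
      unfolding z using i by (subst prod.remove[of _ i]) auto
    moreover have "(\<Prod>i\<in>UNIV - {i}. if ?ok i then ennreal (?F i) else \<infinity>) \<noteq> 0"
      using pos by (auto simp: ennreal_eq_0_iff not_le)
    ultimately have "z_G E U \<alpha> = \<infinity>" by (simp add: ennreal_top_mult)
    then show ?thesis using False by auto
  qed
qed

end
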